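(* Under the simple Hopf pair assumption of the context, let $\boldsymbol{x}=\boldsymbol{x}^*(\alpha)+\boldsymbol{z}$ with $\boldsymbol{z}\sim\mathcal{N}(\boldsymbol{0},C(\alpha))$, let $V=\operatorname{Var}(\boldsymbol{x})$ and $S(\alpha)=\operatorname{Var}(\boldsymbol{x}^*(\alpha))$. Then, as $\alpha\to\alpha_{\mathrm c}^-$, $$\mathbb{E}[V]=S(\alpha)+\frac{\sigma_{\mathrm H}^2}{\eta}\,\frac{1-\rho_{\mathrm H}}{N-1}+O(1),$$ where $\sigma_{\mathrm H}^2=\|B^\top\boldsymbol{w}_{\mathrm H}\|_2^2$ and $\rho_{\mathrm H}=|\boldsymbol{1}^\top\boldsymbol{v}_{\mathrm H}|^2/N$. If moreover the Hopf bifurcation is generic in the sense that $\eta(\alpha)=\kappa_{\mathrm H}(\alpha_{\mathrm c}-\alpha)(1+o(1))$ with $\kappa_{\mathrm H}>0$, and if $\sigma_{\mathrm H,c}^2=\lim_{\alpha\to\alpha_{\mathrm c}^-}\sigma_{\mathrm H}^2>0$, then $\mathbb{E}[V]$ grows in proportion to $(\alpha_{\mathrm c}-\alpha)^{-1}$, i.e. $(\alpha_{\mathrm c}-\alpha)\,\mathbb{E}[V]$ converges to a finite positive limit.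
   Context: Setting. $N\ge2$. Consider the It\^o SDE $\mathrm d\boldsymbol{x}=F(\boldsymbol{x};\alpha)\,\mathrm dt+B\,\mathrm d\boldsymbol{W}$ in $\mathbb{R}^N$, with $B\in\mathbb{R}^{N\times m}$ constant, $\boldsymbol{W}$ an $m$-dimensional standard Wiener process, and $F$ sufficiently smooth in $(\boldsymbol{x},\alpha)$ ($C^2$ in a neighborhood of the equilibrium branch, including its endpoint at $\alpha_{\mathrm c}$, suffices). $\boldsymbol{x}^*(\alpha)$ is a branch of equilibria, asymptotically stable for $\alpha<\alpha_{\mathrm c}$; $M(\alpha)=-\frac{\partial F}{\partial\boldsymbol{x}}\big|_{\boldsymbol{x}=\boldsymbol{x}^*(\alpha)}$; $C(\alpha)$ solves $MC+CM^\top=BB^\top$. Simple Hopf pair assumption. $\boldsymbol{x}^*(\alpha)$ has a finite limit $\boldsymbol{x}^*_{\mathrm c}$ as $\alpha\to\alpha_{\mathrm c}^-$. For $\alpha<\alpha_{\mathrm c}$ close to $\alpha_{\mathrm c}$, the real matrix $M(\alpha)$ is diagonalizable over $\mathbb{C}$ and has a simple complex-conjugate eigenvalue pair $\lambda_\pm(\alpha)=\eta(\alpha)\pm\mathrm i\,\Omega(\alpha)$ with $\eta(\alpha)>0$, $\eta(\alpha)\to0$, $\Omega(\alpha)\to\Omega_{\mathrm c}>0$; all other eigenvalues satisfy $\operatorname{Re}\lambda_k(\alpha)\ge\delta>0$ with $\delta$ independent of $\alpha$. $\boldsymbol{v}_{\mathrm H},\overline{\boldsymbol{v}_{\mathrm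 H}}$ are right eigenvectors for $\lambda_+,\lambda_-$ and $\boldsymbol{w}_{\mathrm H},\overline{\boldsymbol{w}_{\mathrm H}}$ the corresponding left eigenvectors ($\boldsymbol{w}_{\mathrm H}^\top M=\lambda_+\boldsymbol{w}_{\mathrm H}^\top$), with $\|\boldsymbol{v}_{\mathrm H}\|_2=1$, $\boldsymbol{w}_{\mathrm H}^\top\boldsymbol{v}_{\mathrm H}=1$, $\boldsymbol{w}_{\mathrm H}^\top\overline{\boldsymbol{v}_{\mathrm H}}=0$ (plain transpose, no conjugation). $\boldsymbol{v}_{\mathrm H}$ and $\boldsymbol{w}_{\mathrm H}$ have finite limits as $\alpha\to\alpha_{\mathrm c}^-$. Notation: $\operatorname{Var}(\boldsymbol{u})=\frac1{N-1}\sum_i(u_i-\bar u)^2$, $\bar u=N^{-1}\sum_iu_i$. *)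

theory Defs
  imports
    "HOL-Analysis.Analysis"
    "HOL-Probability.Probability"
    "HOL-Computational_Algebra.Polynomial"
    "HOL-Library.Landau_Symbols"
begin

text \<open>Twice continuous (Frechet) differentiability; meant for open \<open>U\<close>.\<close>

definition C2_on :: "('a::real_normed_vector \<Rightarrow> 'b::real_normed_vector) \<Rightarrow> 'a set \<Rightarrow> bool" where
  "C2_on f U \<longleftrightarrow>
     (\<exists>(f' :: 'a \<Rightarrow> 'a \<Rightarrow>\<^sub>L 'b) (f'' :: 'a \<Rightarrow> 'a \<Rightarrow>\<^sub>L ('a \<Rightarrow>\<^sub>L 'b)).
        (\<forall>p\<in>U. (f has_derivative blinfun_apply (f' p)) (at p)) \<and>
        (\<forall>p\<in>U. (f' has_derivative blinfun_apply (f'' p)) (at p)) \<and>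
        continuous_on U f'')"

definition solves_ode :: "('a::real_normed_vector \<Rightarrow> 'a) \<Rightarrow> (real \<Rightarrow> 'a) \<Rightarrow> real set \<Rightarrow> bool" where
  "solves_ode f \<phi> T \<longleftrightarrow> (\<forall>t\<in>T. (\<phi> has_vector_derivative f (\<phi> t)) (at t within T))"

text \<open>
  Lyapunov stability together with local attractivity.  Stability is required of every solution on
  every compact interval \<open>{0..T}\<close>, so a solution starting close to \<open>p\<close> cannot leave the
  neighbourhood before blowing up; for a drift that is \<open>C\<^sup>2\<close> near \<open>p\<close>, such solutions
  therefore exist for all positive times.
\<close>

definition asymptotically_stable :: "('a::real_normed_vector \<Rightarrow> 'a) \<Rightarrow> 'a \<Rightarrow> bool" where
  "asymptotically_stable f p \<longleftrightarrow>
     (\<forall>\<epsilon>>0. \<exists>d>0. \<forall>T\<ge>0. \<forall>\<phi>. solves_ode f \<phi> {0..T} \<and> dist (\<phi> 0) p < d \<longrightarrow>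
        (\<forall>t\<in>{0..T}. dist (\<phi> t) p < \<epsilon>)) \<and>
     (\<exists>d>0. \<forall>\<phi>. solves_ode f \<phi> {0..} \<and> dist (\<phi> 0) p < d \<longrightarrow> (\<phi> \<longlongrightarrow> p) at_top)"

definition linearization ::
    "(real^'n \<Rightarrow> real \<Rightarrow> real^'n) \<Rightarrow> (real \<Rightarrow> real^'n) \<Rightarrow> real \<Rightarrow> real^'n^'n" where
  "linearization F xs \<alpha> = - jacobian (\<lambda>x. F x \<alpha>) (at (xs \<alpha>))"

abbreviation cmat :: "real^'n^'m \<Rightarrow> complex^'n^'m" where
  "cmat \<equiv> map_matrix complex_of_real"

definition cnj_vec :: "complex^'n \<Rightarrow> complex^'n" where
  "cnj_vec v = (\<chi> i. cnj (v $ i))"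

text \<open>The bilinear pairing \<open>w\<^sup>T v\<close>; no conjugation.\<close>

definition tdot :: "complex^'n \<Rightarrow> complex^'n \<Rightarrow> complex" where
  "tdot w v = (\<Sum>i\<in>UNIV. w $ i * v $ i)"

definition right_eigenvector :: "'a::field^'n^'n \<Rightarrow> 'a \<Rightarrow> 'a^'n \<Rightarrow> bool" where
  "right_eigenvector A l v \<longleftrightarrow> v \<noteq> 0 \<and> A *v v = l *s v"

definition left_eigenvector :: "'a::field^'n^'n \<Rightarrow> 'a \<Rightarrow> 'a^'n \<Rightarrow> bool" where
  "left_eigenvector A l w \<longleftrightarrow> w \<noteq> 0 \<and> w v* A = l *s w"

definition eigenvalue :: "'a::field^'n^'n \<Rightarrow> 'a \<Rightarrow> bool" where
  "eigenvalue A l \<longleftrightarrow> (\<exists>v. right_eigenvector A l v)"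

definition charpoly :: "'a::field^'n^'n \<Rightarrow> 'a poly" where
  "charpoly A = det (mat [:0, 1:] - map_matrix (\<lambda>c. [:c:]) A)"

definition simple_eigenvalue :: "'a::field^'n^'n \<Rightarrow> 'a \<Rightarrow> bool" where
  "simple_eigenvalue A l \<longleftrightarrow> eigenvalue A l \<and> order l (charpoly A) = 1"

definition diagonalizable :: "'a::field^'n^'n \<Rightarrow> bool" where
  "diagonalizable A \<longleftrightarrow>
     (\<exists>(Q :: 'a^'n^'n) (D :: 'a^'n^'n). invertible Q \<and> (\<forall>i j. i \<noteq> j \<longrightarrow> D $ i $ j = 0) \<and> A = Q ** D ** matrix_inv Q)"

definition simple_hopf_pair ::
    "(real \<Rightarrow> real^'n^'n) \<Rightarrow> real \<Rightarrow> (real \<Rightarrow> real) \<Rightarrow> (real \<Rightarrow> real) \<Rightarrow>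
     (real \<Rightarrow> complex^'n) \<Rightarrow> (real \<Rightarrow> complex^'n) \<Rightarrow> bool" where
  "simple_hopf_pair M \<alpha>c \<eta> \<Omega> v w \<longleftrightarrow>
     (\<forall>\<^sub>F \<alpha> in at_left \<alpha>c.
        diagonalizable (cmat (M \<alpha>)) \<and>
        simple_eigenvalue (cmat (M \<alpha>)) (Complex (\<eta> \<alpha>) (\<Omega> \<alpha>)) \<and>
        simple_eigenvalue (cmat (M \<alpha>)) (Complex (\<eta> \<alpha>) (- \<Omega> \<alpha>)) \<and>
        \<eta> \<alpha> > 0 \<and>
        right_eigenvector (cmat (M \<alpha>)) (Complex (\<eta> \<alpha>) (\<Omega> \<alpha>)) (v \<alpha>) \<and>
        right_eigenvector (cmat (M \<alpha>)) (Complex (\<eta> \<alpha>) (- \<Omega> \<alpha>)) (cnj_vec (v \<alpha>)) \<and>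
        left_eigenvector (cmat (M \<alpha>)) (Complex (\<eta> \<alpha>) (\<Omega> \<alpha>)) (w \<alpha>) \<and>
        left_eigenvector (cmat (M \<alpha>)) (Complex (\<eta> \<alpha>) (- \<Omega> \<alpha>)) (cnj_vec (w \<alpha>)) \<and>
        norm (v \<alpha>) = 1 \<and> tdot (w \<alpha>) (v \<alpha>) = 1 \<and> tdot (w \<alpha>) (cnj_vec (v \<alpha>)) = 0) \<and>
     (\<eta> \<longlongrightarrow> 0) (at_left \<alpha>c) \<and>
     (\<exists>\<Omega>c>0. (\<Omega> \<longlongrightarrow> \<Omega>c) (at_left \<alpha>c)) \<and>
     (\<exists>\<delta>>0. \<forall>\<^sub>F \<alpha> in at_left \<alpha>c. \<forall>\<mu>.
        eigenvalue (cmat (M \<alpha>)) \<mu> \<and>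
        \<mu> \<noteq> Complex (\<eta> \<alpha>) (\<Omega> \<alpha>) \<and> \<mu> \<noteq> Complex (\<eta> \<alpha>) (- \<Omega> \<alpha>) \<longrightarrow> Re \<mu> \<ge> \<delta>) \<and>
     (\<exists>vc. (v \<longlongrightarrow> vc) (at_left \<alpha>c)) \<and>
     (\<exists>wc. (w \<longlongrightarrow> wc) (at_left \<alpha>c))"

definition hopf_noise :: "real^'m^'n \<Rightarrow> complex^'n \<Rightarrow> real" where
  "hopf_noise B w = (norm (transpose (cmat B) *v w))\<^sup>2"

definition hopf_rho :: "complex^'n \<Rightarrow> real" where
  "hopf_rho v = (cmod (\<Sum>i\<in>UNIV. v $ i))\<^sup>2 / real CARD('n)"

definition vec_mean :: "real^'n \<Rightarrow> real" where
  "vec_mean u = (\<Sum>i\<in>UNIV. u $ i) / real CARD('n)"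

definition vec_var :: "real^'n \<Rightarrow> real" where
  "vec_var u = (\<Sum>i\<in>UNIV. (u $ i - vec_mean u)\<^sup>2) / (real CARD('n) - 1)"

definition normal_law :: "real \<Rightarrow> real \<Rightarrow> real measure" where
  "normal_law m s2 =
     (if s2 = 0 then return borel m
      else density lborel (\<lambda>x. ennreal (normal_density m (sqrt s2) x)))"

text \<open>
  \<open>Z \<sim> N(\<mu>, \<Sigma>)\<close> through the one-dimensional projections.  The covariance may be singular, as
  \<open>B B\<^sup>T\<close> need not have full rank, so a Lebesgue density cannot be used.
\<close>

definition gaussian_vector ::
    "'w measure \<Rightarrow> ('w \<Rightarrow> real^'n) \<Rightarrow> real^'n \<Rightarrow> real^'n^'n \<Rightarrow> bool" where
  "gaussian_vector P Z \<mu> \<Sigma> \<longleftrightarrow>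
     prob_space P \<and> Z \<in> borel_measurable P \<and>
     transpose \<Sigma> = \<Sigma> \<and> (\<forall>a. a \<bullet> (\<Sigma> *v a) \<ge> 0) \<and>
     (\<forall>a. distr P borel (\<lambda>\<omega>. a \<bullet> Z \<omega>) = normal_law (a \<bullet> \<mu>) (a \<bullet> (\<Sigma> *v a)))"

end

(*
  Write D = B B^T, s = |B^T w|^2 and let v^H denote the conjugate transpose of v.  The part of C that
  blows up is (s / (2 eta)) (v v^H + cnj (v v^H)); call R the remainder.  The Lyapunov operator
  X |-> M X + X M^T is singular in the limit only because its two eigenvalues
  lambda_+ + lambda_- = 2 eta vanish.  Adding the spectral projection onto these two modes moves both
  of them to 2 eta + 1, and R is the solution of the modified equation with right-hand side
  D - s (v v^H + cnj (v v^H)).  The modified operator has bounded entries and all its eigenvalues stay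
  away from 0, hence so does its determinant, and Cramer's rule bounds R.  This needs no control of
  the conditioning of the eigenbasis, which may degenerate as alpha tends to alpha_c.

  The limit constant is positive because rho_H = 1 would make v_c a multiple of the all-ones vector,
  so that cnj v_c would be a multiple of v_c, against w_c^T v_c = 1 and w_c^T (cnj v_c) = 0.
*)

theory Submission
  imports Defs
begin

section \<open>Rank-one matrices, Kronecker products and flattening of matrices\<close>

definition outer :: "'a::times^'m \<Rightarrow> 'a^'n \<Rightarrow> 'a^'n^'m" where
  "outer a b = (\<chi> i j. a $ i * b $ j)"

definition kron :: "'a::times^'n^'m \<Rightarrow> 'a^'k^'l \<Rightarrow> 'a^('n \<times> 'k)^('m \<times> 'l)" where
  "kron A B = (\<chi> p q. A $ fst p $ fst q * B $ snd p $ snd q)"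

text \<open>Flattening turns linear maps on matrices into square matrices, to which
  \<open>det\<close> and Cramer's rule apply. The entries are ordered by (row, column), so
  \<open>kron A B\<close> acts as X |-> A X B^T; column stacking would give B X A^T.\<close>

definition vec_of_mat :: "'a^'n^'m \<Rightarrow> 'a^('m \<times> 'n)" where
  "vec_of_mat X = (\<chi> p. X $ fst p $ snd p)"

lemma sum_UNIV_prod:
  "(\<Sum>p\<in>(UNIV :: ('m::finite \<times> 'n::finite) set). f p) = (\<Sum>i\<in>UNIV. \<Sum>j\<in>UNIV. f (i, j))"
  by (simp add: sum.cartesian_product flip: UNIV_Times_UNIV)

lemma matrix_diff_ldistrib:
  fixes A :: "'a::ring_1^'n^'m"
  shows "A ** (B - C) = A ** B - A ** C"
  by (simp add: vec_eq_iff matrix_matrix_mult_def right_diff_distrib sum_subtractf)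

lemma matrix_diff_rdistrib:
  fixes A :: "'a::ring_1^'n^'m"
  shows "(A - B) ** C = A ** C - B ** C"
  by (simp add: vec_eq_iff matrix_matrix_mult_def left_diff_distrib sum_subtractf)

lemma kron_mult:
  fixes A :: "'a::comm_semiring_1^'n^'m" and B :: "'a^'k^'l"
  shows "kron A B ** kron C D = kron (A ** C) (B ** D)"
proof -
  have "(\<Sum>i\<in>UNIV. \<Sum>j\<in>UNIV. A $ a $ i * B $ b $ j * (C $ i $ c * D $ j $ d)) =
      (\<Sum>i\<in>UNIV. A $ a $ i * C $ i $ c) * (\<Sum>j\<in>UNIV. B $ b $ j * D $ j $ d)" for a b c d
    unfolding sum_product by (simp add: mult_ac)
  then show ?thesis
    by (simp add: vec_eq_iff kron_def matrix_matrix_mult_def sum_UNIV_prod)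
qed

lemma kron_vec_of_mat:
  fixes A :: "'a::comm_semiring_1^'n^'m" and B :: "'a^'k^'l"
  shows "kron A B *v vec_of_mat X = vec_of_mat (A ** X ** transpose B)"
proof -
  have "(\<Sum>i\<in>UNIV. \<Sum>j\<in>UNIV. A $ fst p $ i * B $ snd p $ j * X $ i $ j) =
     (\<Sum>j\<in>UNIV. (\<Sum>i\<in>UNIV. A $ fst p $ i * X $ i $ j) * B $ snd p $ j)" for p
    by (subst sum.swap) (simp add: sum_distrib_left sum_distrib_right mult_ac)
  then show ?thesis
    by (simp add: vec_eq_iff kron_def vec_of_mat_def transpose_def matrix_matrix_mult_def
        matrix_vector_mult_def sum_UNIV_prod)
qed

lemma kron_mat_1: "kron (mat 1) (mat 1) = (mat 1 :: 'a::comm_semiring_1^('n::finite \<times> 'm::finite)^('n \<times> 'm))"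
  by (simp add: vec_eq_iff kron_def mat_def prod_eq_iff)

lemma invertible_kron:
  fixes A :: "'a::comm_semiring_1^'n^'n" and B :: "'a^'m^'m"
  assumes "invertible A" "invertible B"
  shows "invertible (kron A B)"
proof -
  obtain A' B' where "A ** A' = mat 1" "A' ** A = mat 1" "B ** B' = mat 1" "B' ** B = mat 1"
    using assms unfolding invertible_def by blast
  then have "kron A B ** kron A' B' = mat 1 \<and> kron A' B' ** kron A B = mat 1"
    by (simp add: kron_mult kron_mat_1)
  then show ?thesis
    unfolding invertible_def by blast
qed

section \<open>Similarity, determinant bounds and Cramer's rule\<close>

lemma det_similar:
  fixes A S D :: "'a::field^'n^'n"
  assumes "invertible S" "A ** S = S ** D"
  shows "det A = det D"
proof -
  have "det A * det S = det S * det D"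
    using assms(2) by (metis det_mul)
  then show ?thesis
    using assms(1) by (simp add: invertible_det_nz)
qed

lemma norm_det_le:
  fixes A :: "complex^'n^'n"
  assumes "\<And>i j. cmod (A $ i $ j) \<le> b"
  shows "cmod (det A) \<le> fact CARD('n) * b ^ CARD('n)"
proof -
  have "cmod (det A) \<le> (\<Sum>p | p permutes (UNIV :: 'n set).
      cmod (of_int (sign p) * (\<Prod>i\<in>UNIV. A $ i $ p i)))"
    unfolding det_def by (rule norm_sum)
  also have "\<dots> \<le> (\<Sum>p | p permutes (UNIV :: 'n set). b ^ CARD('n))"
  proof (rule sum_mono)
    fix p :: "'n \<Rightarrow> 'n"
    have "(\<Prod>i\<in>UNIV. cmod (A $ i $ p i)) \<le> (\<Prod>i\<in>(UNIV :: 'n set). b)"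
      by (intro prod_mono) (simp add: assms)
    then show "cmod (of_int (sign p) * (\<Prod>i\<in>UNIV. A $ i $ p i)) \<le> b ^ CARD('n)"
      by (simp add: norm_mult prod_norm sign_def)
  qed
  also have "\<dots> = fact CARD('n) * b ^ CARD('n)"
    by (simp add: card_permutations)
  finally show ?thesis .
qed

text \<open>The numerator in Cramer's rule is the determinant of \<open>A\<close> with one column
  replaced by \<open>r\<close>, so the same entry bound \<open>b\<close> applies to it. A lower
  bound on the determinant thus takes the place of a bound on the inverse.\<close>

lemma norm_solution_le:
  fixes A :: "complex^'n^'n"
  assumes "A *v x = r" and c: "0 < c" "c \<le> cmod (det A)"
    and b: "\<And>i j. cmod (A $ i $ j) \<le> b" "\<And>i. cmod (r $ i) \<le> b"
  shows "cmod (x $ k) \<le> fact CARD('n) * b ^ CARD('n) / c"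
proof -
  have "det A \<noteq> 0" using c by auto
  then have "x = (\<chi> k. det (\<chi> i j. if j = k then r $ i else A $ i $ j) / det A)"
    using cramer assms(1) by blast
  then have x: "x $ k = det (\<chi> i j. if j = k then r $ i else A $ i $ j) / det A"
    using arg_cong[where f = "\<lambda>y. y $ k"] by simp
  have "cmod (det (\<chi> i j. if j = k then r $ i else A $ i $ j)) \<le> fact CARD('n) * b ^ CARD('n)"
    by (rule norm_det_le) (simp add: b)
  then show ?thesis
    unfolding x norm_divide using c by (intro frac_le) (auto intro: order.trans[OF norm_ge_zero])
qed

section \<open>Diagonalized matrices and spectral projections\<close>

lemma diagonalizable_similar:
  fixes A :: "'a::field^'n^'n"
  assumes "diagonalizable A"
  shows "\<exists>(Q :: 'a^'n^'n) (D :: 'a^'n^'n).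
    invertible Q \<and> A ** Q = Q ** D \<and> (\<forall>i j. i \<noteq> j \<longrightarrow> D $ i $ j = 0)"
proof -
  obtain Q D :: "'a^'n^'n" where Q: "invertible Q" "A = Q ** D ** matrix_inv Q"
    and D: "\<forall>i j. i \<noteq> j \<longrightarrow> D $ i $ j = 0"
    using assms unfolding diagonalizable_def by blast
  have "matrix_inv Q ** Q = mat 1"
    using Q(1) unfolding invertible_def matrix_inv_def by (metis (mono_tags, lifting) someI_ex)
  then have "A ** Q = Q ** D"
    by (metis Q(2) matrix_mul_assoc matrix_mul_rid)
  with Q(1) D show ?thesis by blast
qed

lemma column_mult: "column j (A ** Q) = A *v column j Q"
  by (simp add: vec_eq_iff column_def matrix_matrix_mult_def matrix_vector_mult_def)

lemma column_mult_diagonal: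
  fixes Q D :: "'a::comm_semiring_1^'n^'n"
  assumes "\<And>i j. i \<noteq> j \<Longrightarrow> D $ i $ j = 0"
  shows "column j (Q ** D) = D $ j $ j *s column j Q"
proof -
  have "(\<Sum>k\<in>UNIV. Q $ i $ k * D $ k $ j) = (\<Sum>k\<in>UNIV. if k = j then Q $ i $ j * D $ j $ j else 0)" for i
    by (rule sum.cong) (auto simp: assms)
  then show ?thesis
    by (simp add: vec_eq_iff column_def matrix_matrix_mult_def mult.commute)
qed

text \<open>The columns of an invertible \<open>Q\<close> with A Q = Q D are nonzero eigenvectors.
  Spectral hypotheses stated through \<open>eigenvalue\<close> thereby apply to the diagonal of
  \<open>D\<close>.\<close>

lemma diagonal_entry_eigenvalue:
  fixes A Q D :: "'a::field^'n^'n"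
  assumes Q: "invertible Q" "A ** Q = Q ** D" and D: "\<And>i j. i \<noteq> j \<Longrightarrow> D $ i $ j = 0"
  shows "eigenvalue A (D $ j $ j)"
proof -
  have "A *v column j Q = D $ j $ j *s column j Q"
    by (metis Q(2) column_mult column_mult_diagonal D)
  moreover have "column j Q \<noteq> 0"
  proof
    assume 0: "column j Q = 0"
    obtain R where "R ** Q = mat 1" using Q(1) unfolding invertible_def by blast
    then have "column j (mat 1 :: 'a^'n^'n) = 0"
      by (metis column_mult[of j R Q] 0 matrix_vector_mult_0_right)
    then show False by (auto simp: column_def mat_def vec_eq_iff dest: spec[of _ j])
  qed
  ultimately show ?thesis
    unfolding eigenvalue_def right_eigenvector_def by blast
qed

lemma charpoly_diagonalized:
  fixes A Q D :: "'a::field^'n^'n"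
  assumes Q: "invertible Q" "A ** Q = Q ** D" and D: "\<And>i j. i \<noteq> j \<Longrightarrow> D $ i $ j = 0"
  shows "charpoly A = (\<Prod>i\<in>UNIV. [:- (D $ i $ i), 1:])"
proof -
  let ?p = "map_matrix (\<lambda>c :: 'a. [:c:]) :: 'a^'n^'n \<Rightarrow> 'a poly^'n^'n"
  have hom: "[:\<Sum>k\<in>S. f k:] = (\<Sum>k\<in>S. [:f k:])" for f :: "'n \<Rightarrow> 'a" and S
    by (simp add: poly_eq_iff coeff_sum coeff_pCons split: nat.split)
  have p_mult: "?p (X ** Y) = ?p X ** ?p Y" for X Y
    by (simp add: vec_eq_iff matrix_matrix_mult_def hom mult.commute)
  have X_comm: "mat [:0, 1:] ** X = X ** mat [:0, 1:]" for X :: "'a poly^'n^'n"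
    by (simp add: vec_eq_iff matrix_matrix_mult_def mat_def if_distrib if_distribR cong: if_cong)
  have "(mat [:0, 1:] - ?p A) ** ?p Q = ?p Q ** (mat [:0, 1:] - ?p D)"
    by (simp add: matrix_diff_rdistrib matrix_diff_ldistrib X_comm Q(2) flip: p_mult)
  then have "det ((mat [:0, 1:] - ?p A) ** ?p Q) = det (?p Q ** (mat [:0, 1:] - ?p D))"
    by (rule arg_cong)
  then have eq: "charpoly A * det (?p Q) = charpoly D * det (?p Q)"
    by (simp only: charpoly_def det_mul mult.commute)
  obtain R where "Q ** R = mat 1" using Q(1) unfolding invertible_def by blast
  then have "?p Q ** ?p R = mat 1"
    unfolding p_mult[symmetric] by (simp add: vec_eq_iff mat_def)
  then have "det (?p Q) \<noteq> 0"
    using det_mul[of "?p Q" "?p R"] by auto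
  with eq have "charpoly A = charpoly D" by simp
  also have "\<dots> = (\<Prod>i\<in>UNIV. [:- (D $ i $ i), 1:])"
    unfolding charpoly_def by (subst det_diagonal) (auto simp: mat_def D)
  finally show ?thesis .
qed

lemma tdot_mult: "tdot w (A *v x) = tdot (w v* A) x"
proof -
  have "tdot w (A *v x) = (\<Sum>i\<in>UNIV. \<Sum>j\<in>UNIV. w $ i * A $ i $ j * x $ j)"
    by (simp add: tdot_def matrix_vector_mult_def sum_distrib_left mult_ac)
  also have "\<dots> = tdot (w v* A) x"
    by (subst sum.swap) (simp add: tdot_def vector_matrix_mult_def sum_distrib_right)
  finally show ?thesis .
qed

lemma tdot_scale [simp]: "tdot (c *s w) x = c * tdot w x" "tdot w (c *s x) = c * tdot w x"
  by (simp_all add: tdot_def sum_distrib_left mult_ac)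

text \<open>Two diagonal positions carrying \<open>l\<close> would make (X - l)^2 divide the
  characteristic polynomial, against order 1.\<close>

lemma simple_eigenvalue_diagonal_unique:
  fixes A Q D :: "'a::field^'n^'n"
  assumes Q: "invertible Q" "A ** Q = Q ** D" and D: "\<And>i j. i \<noteq> j \<Longrightarrow> D $ i $ j = 0"
    and l: "simple_eigenvalue A l" "D $ j $ j = l" "D $ k $ k = l"
  shows "j = k"
proof (rule ccontr)
  assume "j \<noteq> k"
  have cp: "charpoly A = (\<Prod>i\<in>UNIV. [:- (D $ i $ i), 1:])"
    by (rule charpoly_diagonalized[OF Q D])
  have "(\<Prod>i\<in>{j, k}. [:- (D $ i $ i), 1:]) dvd charpoly A"
    unfolding cp by (rule prod_dvd_prod_subset) auto
  then have "[:- l, 1:] ^ 2 dvd charpoly A"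
    using \<open>j \<noteq> k\<close> l by (simp add: power2_eq_square)
  moreover have "charpoly A \<noteq> 0"
    unfolding cp by simp
  ultimately show False
    using l(1) unfolding order_divides simple_eigenvalue_def by simp
qed

text \<open>The matrix v w^T is the spectral projection for \<open>l\<close>. The left eigenvector
  \<open>w\<close> annihilates every column of \<open>Q\<close> with another eigenvalue; simplicity
  makes \<open>v\<close> a multiple of the one remaining column, and w^T v = 1 fixes the
  scale.\<close>

lemma outer_diagonalized:
  fixes A Q D :: "complex^'n^'n"
  assumes Q: "invertible Q" "A ** Q = Q ** D" and D: "\<And>i j. i \<noteq> j \<Longrightarrow> D $ i $ j = 0"
    and l: "simple_eigenvalue A l"
    and v: "right_eigenvector A l v" and w: "left_eigenvector A l w" and wv: "tdot w v = 1"
  shows "outer v w ** Q = Q ** (\<chi> i j. if i = j \<and> D $ i $ i = l then 1 else 0)"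
proof -
  have col: "A *v column j Q = D $ j $ j *s column j Q" for j
    by (metis Q(2) column_mult column_mult_diagonal D)
  have orth: "tdot w (column j Q) = 0" if "D $ j $ j \<noteq> l" for j
  proof -
    have "tdot w (A *v column j Q) = l * tdot w (column j Q)"
      using w by (simp add: tdot_mult left_eigenvector_def)
    moreover have "tdot w (A *v column j Q) = D $ j $ j * tdot w (column j Q)"
      by (simp only: col tdot_scale)
    ultimately have "l * tdot w (column j Q) = D $ j $ j * tdot w (column j Q)"
      by metis
    with that show ?thesis by (metis mult_cancel_right)
  qed
  have eig: "v $ i * tdot w (column j Q) = Q $ i $ j" if j: "D $ j $ j = l" for i j
  proof -
    obtain R where R: "R ** Q = mat 1" "Q ** R = mat 1"
      using Q(1) unfolding invertible_def by blast
    \<comment> \<open>The coordinates of \<open>v\<close> in the eigenbasis satisfy D c = l c, so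
      they vanish away from the single position \<open>j\<close> of \<open>l\<close>.\<close>
    define c where "c = R *v v"
    have vc: "v = Q *v c"
      by (simp add: c_def matrix_vector_mul_assoc R)
    have "Q *v (D *v c) = Q *v (l *s c)"
      using v vc Q(2) unfolding right_eigenvector_def
      by (metis matrix_vector_mul_assoc vector_scalar_commute)
    then have Dc: "D *v c = l *s c"
      by (metis R(1) matrix_vector_mul_assoc matrix_vector_mul_lid)
    have "(\<Sum>m\<in>UNIV. D $ k $ m * c $ m) = (\<Sum>m\<in>UNIV. if m = k then D $ k $ k * c $ k else 0)" for k
      by (rule sum.cong) (auto simp: D)
    then have "D $ k $ k * c $ k = l * c $ k" for k
      using arg_cong[OF Dc, of "\<lambda>x. x $ k"] by (simp add: matrix_vector_mult_def)
    then have c0: "c $ k = 0" if "k \<noteq> j" for k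
      using that simple_eigenvalue_diagonal_unique[OF Q D l j, of k] by auto
    have "(\<Sum>k\<in>UNIV. Q $ m $ k * c $ k) = (\<Sum>k\<in>UNIV. if k = j then Q $ m $ j * c $ j else 0)" for m
      by (rule sum.cong) (auto simp: c0)
    then have v_eq: "v = c $ j *s column j Q"
      by (subst vc) (simp add: vec_eq_iff matrix_vector_mult_def column_def mult.commute)
    show ?thesis
      using wv unfolding v_eq by (simp add: column_def mult_ac)
  qed
  have "(outer v w ** Q) $ i $ j = v $ i * tdot w (column j Q)" for i j
    by (simp add: outer_def matrix_matrix_mult_def tdot_def column_def sum_distrib_left mult_ac)
  moreover have "(Q ** (\<chi> i j. if i = j \<and> D $ i $ i = l then 1 else 0)) $ i $ j
      = (if D $ j $ j = l then Q $ i $ j else 0)" for i j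
  proof -
    have "(\<Sum>k\<in>UNIV. Q $ i $ k * (if k = j \<and> D $ k $ k = l then 1 else 0)) =
       (\<Sum>k\<in>UNIV. if k = j then (if D $ j $ j = l then Q $ i $ j else 0) else 0)"
      by (rule sum.cong) auto
    then show ?thesis by (simp add: matrix_matrix_mult_def)
  qed
  ultimately show ?thesis
    by (simp add: vec_eq_iff orth eig)
qed

section \<open>The modified Lyapunov operator and its determinant\<close>

text \<open>With P = v w^T and P' = v' w'^T this is the matrix of X |-> A X + X A^T + P X P'^T + P'
  X P^T. For spectral projections P and P' of distinct simple eigenvalues, the last two terms
  together project onto the span of v v'^T and v' v^T.\<close>

definition shifted_lyapunov ::
    "complex^'n^'n \<Rightarrow> complex^'n \<Rightarrow> complex^'n \<Rightarrow> complex^'n \<Rightarrow> complex^'n \<Rightarrow>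
     complex^('n \<times> 'n)^('n \<times> 'n)" where
  "shifted_lyapunov A v w v' w' =
     kron A (mat 1) + kron (mat 1) A + kron (outer v w) (outer v' w') + kron (outer v' w') (outer v w)"

lemma matrix_add_rdistrib: "(A + B) ** C = A ** C + B ** C"
  by (simp add: vec_eq_iff matrix_matrix_mult_def distrib_right sum.distrib)

text \<open>The matrix \<open>kron Q Q\<close> diagonalizes all four summands at once, and
  similarity removes \<open>Q\<close> from the determinant. The diagonal entries are sums of two
  eigenvalues, raised by 1 exactly when these are \<open>l\<close> and \<open>l'\<close> in some
  order, and each has modulus at least \<open>c\<close>.\<close>

lemma det_shifted_lyapunov_ge:
  fixes A :: "complex^'n^'n"
  assumes diag: "diagonalizable A"
    and l: "simple_eigenvalue A l" "right_eigenvector A l v" "left_eigenvector A l w" "tdot w v = 1"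
    and l': "simple_eigenvalue A l'" "right_eigenvector A l' v'" "left_eigenvector A l' w'" "tdot w' v' = 1"
    and other: "\<And>\<mu>. eigenvalue A \<mu> \<Longrightarrow> \<mu> \<noteq> l \<Longrightarrow> \<mu> \<noteq> l' \<Longrightarrow> c \<le> Re \<mu>"
    and "l \<noteq> l'" "0 \<le> Re l" "0 \<le> Re l'" "0 < c"
    and gap: "c \<le> cmod (l + l)" "c \<le> cmod (l' + l')" "c \<le> cmod (l + l' + 1)"
  shows "c ^ CARD('n \<times> 'n) \<le> cmod (det (shifted_lyapunov A v w v' w'))"
proof -
  obtain Q D :: "complex^'n^'n"
    where Q: "invertible Q" "A ** Q = Q ** D" and D': "\<forall>i j. i \<noteq> j \<longrightarrow> D $ i $ j = 0"
    using diagonalizable_similar[OF diag] by blast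
  have D: "D $ i $ j = 0" if "i \<noteq> j" for i j
    using D' that by blast
  define E :: "complex \<Rightarrow> complex^'n^'n"
    where "E m = (\<chi> i j. if i = j \<and> D $ i $ i = m then 1 else 0)" for m
  define \<Delta> where "\<Delta> = kron D (mat 1) + kron (mat 1) D + kron (E l) (E l') + kron (E l') (E l)"
  have outer: "outer v w ** Q = Q ** E l"
    unfolding E_def by (rule outer_diagonalized[OF Q D l])
  have outer': "outer v' w' ** Q = Q ** E l'"
    unfolding E_def by (rule outer_diagonalized[OF Q D l'])
  have "shifted_lyapunov A v w v' w' ** kron Q Q = kron Q Q ** \<Delta>"
    by (simp add: shifted_lyapunov_def \<Delta>_def matrix_add_rdistrib matrix_add_ldistrib kron_mult outer outer' Q)
  then have "det (shifted_lyapunov A v w v' w') = det \<Delta>"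
    by (rule det_similar[OF invertible_kron[OF Q(1) Q(1)]])
  also have "\<dots> = (\<Prod>p\<in>UNIV. \<Delta> $ p $ p)"
    by (rule det_diagonal) (auto simp: \<Delta>_def kron_def E_def mat_def D)
  finally have det: "cmod (det (shifted_lyapunov A v w v' w')) = (\<Prod>p\<in>UNIV. cmod (\<Delta> $ p $ p))"
    by (simp add: prod_norm)
  have "c \<le> cmod (\<Delta> $ p $ p)" for p
  proof -
    obtain i j where p: "p = (i, j)" by (cases p)
    let ?a = "D $ i $ i" and ?b = "D $ j $ j"
    have \<Delta>p: "\<Delta> $ p $ p = ?a + ?b + of_bool (?a = l \<and> ?b = l') + of_bool (?a = l' \<and> ?b = l)"
      by (simp add: p \<Delta>_def kron_def E_def mat_def)
    have ev: "?a = l \<or> ?a = l' \<or> c \<le> Re ?a" "?b = l \<or> ?b = l' \<or> c \<le> Re ?b"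
      using other diagonal_entry_eigenvalue[OF Q D] by blast+
    show ?thesis
    proof (cases "?a \<in> {l, l'} \<and> ?b \<in> {l, l'}")
      \<comment> \<open>The three bounds in \<open>gap\<close> match the sums l + l, l' + l' and the
        raised sum l + l' + 1. As \<open>l\<close> and \<open>l'\<close> differ, at most one of the
        two indicators is 1.\<close>
      case True
      then show ?thesis
        unfolding \<Delta>p using gap \<open>l \<noteq> l'\<close> by (auto simp: add.commute)
    next
      case False
      then have "\<not> (?a = l \<and> ?b = l')" "\<not> (?a = l' \<and> ?b = l)"
        by blast+
      then have "\<Delta> $ p $ p = ?a + ?b"
        by (simp only: \<Delta>p of_bool_def if_False add_0_right)
      moreover have "c \<le> Re ?a \<or> c \<le> Re ?b"
        using ev False by blast
      moreover have "0 \<le> Re ?a" "0 \<le> Re ?b"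
        using ev \<open>0 \<le> Re l\<close> \<open>0 \<le> Re l'\<close> \<open>0 < c\<close> by (metis order.strict_implies_order order.trans)+
      ultimately have "c \<le> Re (\<Delta> $ p $ p)"
        by (metis add_increasing add_increasing2 plus_complex.sel(1))
      then show ?thesis
        using complex_Re_le_cmod order.trans by blast
    qed
  qed
  then have "(\<Prod>p\<in>(UNIV :: ('n \<times> 'n) set). c) \<le> (\<Prod>p\<in>UNIV. cmod (\<Delta> $ p $ p))"
    using \<open>0 < c\<close> by (intro prod_mono) auto
  then show ?thesis
    unfolding det by simp
qed

lemma cnj_vec_nth [simp]: "cnj_vec x $ i = cnj (x $ i)"
  by (simp add: cnj_vec_def)

lemma vec_of_mat_nth [simp]: "vec_of_mat X $ (i, j) = X $ i $ j"
  by (simp add: vec_of_mat_def)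

lemma outer_mult_vec: "outer v w *v x = tdot w x *s v"
  by (simp add: vec_eq_iff outer_def matrix_vector_mult_def tdot_def sum_distrib_left mult_ac)

lemma kron_outer:
  fixes A :: "complex^'n^'n" and B :: "complex^'m^'m"
  shows "kron A B *v vec_of_mat (outer x y) = vec_of_mat (outer (A *v x) (B *v y))"
proof -
  have "(\<Sum>k\<in>UNIV. (\<Sum>m\<in>UNIV. A $ i $ m * (x $ m * y $ k)) * B $ j $ k) =
      (\<Sum>m\<in>UNIV. A $ i $ m * x $ m) * (\<Sum>k\<in>UNIV. B $ j $ k * y $ k)" for i j
    unfolding sum_distrib_right by (subst sum.swap) (simp add: sum_distrib_left mult_ac)
  then have "A ** outer x y ** transpose B = outer (A *v x) (B *v y)"
    by (simp add: vec_eq_iff outer_def matrix_matrix_mult_def matrix_vector_mult_def transpose_def)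
  then show ?thesis by (simp add: kron_vec_of_mat)
qed

text \<open>Rank-one factors on both sides retain a single scalar of \<open>X\<close>. The terms
  added to the Lyapunov operator therefore see the covariance only through pairings with left
  eigenvectors.\<close>

lemma outer_sandwich:
  "vec_of_mat (outer v w ** X ** transpose (outer v' w')) = tdot w (X *v w') *s vec_of_mat (outer v v')"
proof -
  have "(\<Sum>k\<in>UNIV. (\<Sum>m\<in>UNIV. v $ i * w $ m * X $ m $ k) * (v' $ j * w' $ k)) =
      (\<Sum>m\<in>UNIV. w $ m * (\<Sum>k\<in>UNIV. X $ m $ k * w' $ k)) * (v $ i * v' $ j)" for i j
    unfolding sum_distrib_left sum_distrib_right by (subst sum.swap) (simp add: mult_ac)
  then show ?thesis
    by (simp add: vec_eq_iff vec_of_mat_def outer_def matrix_matrix_mult_def transpose_def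
        matrix_vector_mult_def tdot_def)
qed

text \<open>Pairing the equation with left eigenvectors on both sides replaces \<open>A\<close> by
  \<open>l\<close> and its transpose by \<open>l'\<close>. This gives the component of the solution
  along a singular mode exactly.\<close>

lemma tdot_lyapunov:
  fixes A :: "complex^'n^'n"
  assumes "A ** X + X ** transpose A = Y"
    and w: "w v* A = l *s w" "w' v* A = l' *s w'"
  shows "(l + l') * tdot w (X *v w') = tdot w (Y *v w')"
proof -
  have "transpose A *v w' = l' *s w'"
    using w(2) by (simp add: matrix_vector_mult_def vector_matrix_mult_def transpose_def vec_eq_iff mult.commute)
  then have "Y *v w' = A *v (X *v w') + l' *s (X *v w')"
    unfolding assms(1)[symmetric]
    by (simp add: matrix_vector_mult_add_rdistrib vector_scalar_commute flip: matrix_vector_mul_assoc)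
  then have "tdot w (Y *v w') = tdot w (A *v (X *v w')) + l' * tdot w (X *v w')"
    by (simp add: tdot_def distrib_left sum.distrib sum_distrib_left mult_ac)
  also have "tdot w (A *v (X *v w')) = l * tdot w (X *v w')"
    by (simp only: tdot_mult[of w A] w(1) tdot_scale)
  finally show ?thesis
    by (simp only: distrib_right)
qed

text \<open>As \<open>B\<close> is real, B^T (cnj w) is the conjugate of B^T w, so both pairings are
  the sum of the squared moduli of the entries of B^T w.\<close>

lemma tdot_noise:
  "tdot w (cmat (B ** transpose B) *v cnj_vec w) = complex_of_real (hopf_noise B w)"
  "tdot (cnj_vec w) (cmat (B ** transpose B) *v w) = complex_of_real (hopf_noise B w)"
proof -
  define u where "u = w v* cmat B"
  have "cmat (B ** transpose B) = cmat B ** transpose (cmat B)"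
    by (simp add: vec_eq_iff matrix_matrix_mult_def transpose_def)
  then have B: "cmat (B ** transpose B) *v x = cmat B *v (x v* cmat B)" for x
    by (metis matrix_vector_mul_assoc transpose_matrix_vector)
  have u: "cnj_vec w v* cmat B = cnj_vec u"
    by (simp add: u_def vec_eq_iff vector_matrix_mult_def)
  have "tdot u (cnj_vec u) = complex_of_real ((norm u)\<^sup>2)"
    by (simp add: tdot_def norm_vec_def L2_set_def sum_nonneg complex_norm_square del: of_real_power)
  moreover have "tdot (cnj_vec u) u = tdot u (cnj_vec u)"
    by (simp add: tdot_def mult.commute)
  ultimately show "tdot w (cmat (B ** transpose B) *v cnj_vec w) = complex_of_real (hopf_noise B w)"
    "tdot (cnj_vec w) (cmat (B ** transpose B) *v w) = complex_of_real (hopf_noise B w)"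
    by (simp_all add: B tdot_mult u hopf_noise_def flip: u_def)
qed

section \<open>Uniform bound on the covariance after removal of the Hopf modes\<close>

text \<open>The bound does not contain \<eta>, so with fixed \<open>b\<close> and \<open>c\<close>
  one constant serves as \<eta> tends to 0. Its shape is that of \<open>norm_solution_le\<close> in
  dimension \<open>CARD('n \<times> 'n)\<close>, with the determinant bound of
  \<open>det_shifted_lyapunov_ge\<close>.\<close>

lemma lyapunov_hopf_bound:
  fixes M C :: "real^'n^'n" and B :: "real^'m^'n" and v w :: "complex^'n" and \<eta> \<Omega> :: real
  defines "l \<equiv> Complex \<eta> \<Omega>" and "l' \<equiv> Complex \<eta> (- \<Omega>)"
  assumes diag: "diagonalizable (cmat M)"
    and simple: "simple_eigenvalue (cmat M) l" "simple_eigenvalue (cmat M) l'"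
    and v: "right_eigenvector (cmat M) l v" "right_eigenvector (cmat M) l' (cnj_vec v)"
    and w: "left_eigenvector (cmat M) l w" "left_eigenvector (cmat M) l' (cnj_vec w)"
    and wv: "norm v = 1" "tdot w v = 1" "tdot w (cnj_vec v) = 0"
    and other: "\<And>\<mu>. eigenvalue (cmat M) \<mu> \<Longrightarrow> \<mu> \<noteq> l \<Longrightarrow> \<mu> \<noteq> l' \<Longrightarrow> c \<le> Re \<mu>"
    and c: "0 < c" "c \<le> 1" "c \<le> \<Omega>" and "0 < \<eta>"
    and lyap: "M ** C + C ** transpose M = B ** transpose B"
    and b: "\<And>i j. \<bar>M $ i $ j\<bar> \<le> b" "\<And>i. cmod (w $ i) \<le> b"
      "\<And>i j. \<bar>(B ** transpose B) $ i $ j\<bar> \<le> b" "hopf_noise B w \<le> b"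
  shows "\<bar>C $ i $ j - hopf_noise B w / \<eta> * Re (v $ i * cnj (v $ j))\<bar>
    \<le> fact CARD('n \<times> 'n) * (3 * b + 2 * b\<^sup>2) ^ CARD('n \<times> 'n) / c ^ CARD('n \<times> 'n)"
proof -
  let ?v = "cnj_vec v" and ?w = "cnj_vec w"
  define K where "K = shifted_lyapunov (cmat M) v w ?v ?w"
  define O1 where "O1 = vec_of_mat (outer v ?v)"
  define O2 where "O2 = vec_of_mat (outer ?v v)"
  \<comment> \<open>The value of w^T C (cnj w): the noise intensity divided by l + l' = 2 \<eta>. It
    is the coefficient of \<open>O1\<close> and \<open>O2\<close> that is subtracted from the
    covariance to form the remainder \<open>x\<close>.\<close>
  define s where "s = complex_of_real (hopf_noise B w / (2 * \<eta>))"
  define x where "x = vec_of_mat (cmat C) - s *s (O1 + O2)"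
  define D where "D = vec_of_mat (cmat (B ** transpose B))"
  define r where "r = D - complex_of_real (hopf_noise B w) *s (O1 + O2)"
  have ll: "l + l' = complex_of_real (2 * \<eta>)"
    by (simp add: l_def l'_def complex_eq_iff)
  have s: "(l + l') * s = complex_of_real (hopf_noise B w)"
    unfolding ll s_def using \<open>0 < \<eta>\<close> by simp
  have wv': "tdot ?w ?v = 1" "tdot ?w v = 0"
  proof -
    have "tdot ?w ?v = cnj (tdot w v)" "tdot ?w v = cnj (tdot w ?v)"
      by (simp_all add: tdot_def)
    then show "tdot ?w ?v = 1" "tdot ?w v = 0" by (simp_all add: wv)
  qed
  have cm: "cmat (X ** Y) = cmat X ** cmat Y" "cmat (X + Y) = cmat X + cmat Y"
    "cmat (transpose X) = transpose (cmat X)" for X Y :: "real^'n^'n"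
    by (simp_all add: vec_eq_iff matrix_matrix_mult_def transpose_def)
  have lyap': "cmat M ** cmat C + cmat C ** transpose (cmat M) = cmat (B ** transpose B)"
    unfolding lyap[symmetric] cm by (rule refl)
  have ss: "tdot w (cmat C *v ?w) = s" "tdot ?w (cmat C *v w) = s"
  proof -
    have "(l + l') * tdot w (cmat C *v ?w) = (l + l') * s" "(l + l') * tdot ?w (cmat C *v w) = (l + l') * s"
      using tdot_lyapunov[OF lyap', of w l ?w l'] tdot_lyapunov[OF lyap', of ?w l' w l] w
      by (simp_all add: left_eigenvector_def tdot_noise s add.commute)
    moreover have "l + l' \<noteq> 0" unfolding ll using \<open>0 < \<eta>\<close> by simp
    ultimately show "tdot w (cmat C *v ?w) = s" "tdot ?w (cmat C *v w) = s"
      by (metis mult_cancel_left)+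
  qed
  have "K *v vec_of_mat (cmat C) = vec_of_mat (cmat M ** cmat C) + vec_of_mat (cmat C ** transpose (cmat M))
      + s *s O1 + s *s O2"
    by (simp add: K_def shifted_lyapunov_def matrix_vector_mult_add_rdistrib kron_vec_of_mat outer_sandwich
        ss O1_def O2_def del: transpose_iff)
  also have "vec_of_mat (cmat M ** cmat C) + vec_of_mat (cmat C ** transpose (cmat M)) = D"
    unfolding D_def lyap'[symmetric] by (simp add: vec_eq_iff vec_of_mat_def)
  finally have KC: "K *v vec_of_mat (cmat C) = D + s *s O1 + s *s O2" .
  \<comment> \<open>Biorthogonality enters here: one added projection fixes \<open>O1\<close> and
    the other kills it because (cnj w)^T v = 0; likewise for \<open>O2\<close>. Hence the eigenvalue
    l + l' is raised by exactly 1.\<close>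
  have KO: "K *v O1 = (l + l' + 1) *s O1" "K *v O2 = (l + l' + 1) *s O2"
    using v unfolding right_eigenvector_def
    by (simp_all add: K_def O1_def O2_def shifted_lyapunov_def matrix_vector_mult_add_rdistrib kron_outer
        outer_mult_vec wv wv') (simp_all add: vec_eq_iff outer_def vec_of_mat_def algebra_simps)
  \<comment> \<open>The multiples of \<open>s\<close> that the projections add to the image of the
    covariance cancel against the 1 in l + l' + 1. What remains is (l + l') s, the noise intensity,
    so the right-hand side \<open>r\<close> has no factor 1 / \<eta>.\<close>
  have "K *v x = D + s *s O1 + s *s O2 - s *s ((l + l' + 1) *s O1 + (l + l' + 1) *s O2)"
    by (simp add: x_def matrix_vector_mult_diff_distrib vector_scalar_commute KC KO matrix_vector_right_distrib)
  also have "\<dots> = D - ((l + l') * s) *s (O1 + O2)"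
    by (simp add: vec_eq_iff algebra_simps)
  finally have Kx: "K *v x = r"
    unfolding s r_def .
  have "c ^ CARD('n \<times> 'n) \<le> cmod (det K)"
    unfolding K_def
  proof (rule det_shifted_lyapunov_ge[OF diag simple(1) v(1) w(1) wv(2) simple(2) v(2) w(2) wv'(1) other])
    \<comment> \<open>The doubled eigenvalues stay away from 0 by their imaginary parts, of size 2
      \<Omega>; the raised sum does so by its real part 2 \<eta> + 1.\<close>
    have "c \<le> \<bar>Im (l + l)\<bar>" "c \<le> \<bar>Im (l' + l')\<bar>"
      using c by (simp_all add: l_def l'_def)
    then show "c \<le> cmod (l + l)" "c \<le> cmod (l' + l')"
      using abs_Im_le_cmod order.trans by blast+
    have "c \<le> Re (l + l' + 1)"
      using c \<open>0 < \<eta>\<close> by (simp add: l_def l'_def)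
    then show "c \<le> cmod (l + l' + 1)"
      using complex_Re_le_cmod order.trans by blast
  qed (use c \<open>0 < \<eta>\<close> in \<open>auto simp: l_def l'_def\<close>)
  moreover have b0: "0 \<le> b"
    using b(2)[of undefined] norm_ge_zero order.trans by blast
  have v1: "cmod (v $ i) \<le> 1" for i
    using Finite_Cartesian_Product.norm_nth_le[of v i] wv(1) by simp
  have vw: "cmod (v $ i * w $ j) \<le> b" for i j
    using mult_mono[OF v1[of i] b(2)[of j]] by (simp add: norm_mult)
  \<comment> \<open>An entry of \<open>K\<close> has two terms of size at most b from
    \<open>M\<close> and two of size at most b^2 from the projections; an entry of \<open>r\<close>
    is at most 3 b. The bound 3 b + 2 b^2 covers both.\<close>
  have Kb: "cmod (K $ p $ q) \<le> 3 * b + 2 * b\<^sup>2" for p q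
  proof -
    obtain i j k m where p: "p = (i, j)" "q = (k, m)" by (cases p, cases q)
    have 1: "cmod (complex_of_real (M $ i $ k) * of_bool (j = m)) \<le> b"
      "cmod (of_bool (i = k) * complex_of_real (M $ j $ m)) \<le> b"
      using b(1)[of i k] b(1)[of j m] b0 by (auto simp: norm_mult)
    have 2: "cmod ((v $ i * w $ k) * cnj (v $ j * w $ m)) \<le> b * b"
      "cmod (cnj (v $ i * w $ k) * (v $ j * w $ m)) \<le> b * b"
      using mult_mono[OF vw[of i k] vw[of j m]] b0 by (simp_all add: norm_mult)
    have "K $ p $ q = complex_of_real (M $ i $ k) * of_bool (j = m) + of_bool (i = k) * complex_of_real (M $ j $ m)
       + (v $ i * w $ k) * cnj (v $ j * w $ m) + cnj (v $ i * w $ k) * (v $ j * w $ m)"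
      by (simp add: K_def shifted_lyapunov_def kron_def outer_def mat_def p)
    also have "cmod \<dots> \<le> b + b + b * b + b * b"
      by (intro norm_triangle_mono 1 2)
    finally show ?thesis using b0 by (simp add: power2_eq_square)
  qed
  have vv: "cmod (v $ i * cnj (v $ j)) \<le> 1" "cmod (cnj (v $ i) * v $ j) \<le> 1" for i j
    using mult_mono[OF v1[of i] v1[of j]] by (simp_all add: norm_mult)
  have rb: "cmod (r $ p) \<le> 3 * b + 2 * b\<^sup>2" for p
  proof -
    obtain i j where p: "p = (i, j)" by (cases p)
    have h: "0 \<le> hopf_noise B w" by (simp add: hopf_noise_def)
    have 1: "cmod (complex_of_real (hopf_noise B w) * (v $ i * cnj (v $ j))) \<le> b * 1"
      "cmod (complex_of_real (hopf_noise B w) * (cnj (v $ i) * v $ j)) \<le> b * 1"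
      unfolding norm_mult[of "complex_of_real _"] using b(4) b0 h vv[of i j] by (intro mult_mono; simp)+
    have "r $ p = complex_of_real ((B ** transpose B) $ i $ j) -
        (complex_of_real (hopf_noise B w) * (v $ i * cnj (v $ j)) + complex_of_real (hopf_noise B w) * (cnj (v $ i) * v $ j))"
      by (simp add: r_def D_def O1_def O2_def outer_def p distrib_left)
    also have "cmod \<dots> \<le> b + (b * 1 + b * 1)"
      using b(3)[of i j] by (intro order.trans[OF norm_triangle_ineq4] add_mono norm_triangle_mono 1) simp
    finally show ?thesis using b0 by (simp add: add_increasing2)
  qed
  ultimately have "cmod (x $ (i, j)) \<le> fact CARD('n \<times> 'n) * (3 * b + 2 * b\<^sup>2) ^ CARD('n \<times> 'n) / c ^ CARD('n \<times> 'n)"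
    using c by (intro norm_solution_le[OF Kx _ _ Kb rb]) auto
  moreover have "x $ (i, j) = complex_of_real (C $ i $ j - hopf_noise B w / \<eta> * Re (v $ i * cnj (v $ j)))"
  proof -
    \<comment> \<open>Adding the two conjugate modes gives twice the real part, which absorbs the 2
      in the denominator of \<open>s\<close>.\<close>
    have Re2: "v $ i * cnj (v $ j) + cnj (v $ i) * v $ j = complex_of_real (2 * Re (v $ i * cnj (v $ j)))"
      by (simp add: complex_eq_iff)
    have "x $ (i, j) = complex_of_real (C $ i $ j) - s * (v $ i * cnj (v $ j) + cnj (v $ i) * v $ j)"
      by (simp add: x_def O1_def O2_def outer_def distrib_left)
    also have "\<dots> = complex_of_real (C $ i $ j - hopf_noise B w / (2 * \<eta>) * (2 * Re (v $ i * cnj (v $ j))))"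
      unfolding Re2 s_def by (simp only: of_real_diff of_real_mult)
    also have "hopf_noise B w / (2 * \<eta>) * (2 * t) = hopf_noise B w / \<eta> * t" for t
      by simp
    finally show ?thesis .
  qed
  ultimately show ?thesis
    by (simp only: norm_of_real)
qed

section \<open>Moments of Gaussian projections and the expected variance\<close>

lemma normal_law_moments:
  assumes "0 \<le> s"
  shows "has_bochner_integral (normal_law 0 s) (\<lambda>x. x) 0"
    and "has_bochner_integral (normal_law 0 s) (\<lambda>x. x\<^sup>2) s"
proof -
  have "has_bochner_integral (normal_law 0 s) (\<lambda>x. x) 0 \<and> has_bochner_integral (normal_law 0 s) (\<lambda>x. x\<^sup>2) s"
  proof (cases "s = 0")
    case True
    have ret: "has_bochner_integral (return borel (0::real)) f (f 0)"
      if "f \<in> borel_measurable borel" for f :: "real \<Rightarrow> real"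
      using that by (simp add: has_bochner_integral_iff integral_return integrable_iff_bounded nn_integral_return)
    have "normal_law 0 s = return borel 0"
      by (simp add: normal_law_def True)
    moreover have "has_bochner_integral (return borel (0::real)) (\<lambda>x. x) 0"
      by (rule ret) measurable
    moreover have "has_bochner_integral (return borel (0::real)) (\<lambda>x. x\<^sup>2) (0\<^sup>2)"
      by (rule ret) measurable
    ultimately show ?thesis
      unfolding True by simp
  next
    case False
    then have "0 < sqrt s" using assms by simp
    \<comment> \<open>The general moment formulas of orders 2 k + 1 and 2 k, taken at k = 0 and k =
      1 respectively.\<close>
    then have "has_bochner_integral lborel (\<lambda>x. normal_density 0 (sqrt s) x *\<^sub>R x) 0"
      "has_bochner_integral lborel (\<lambda>x. normal_density 0 (sqrt s) x *\<^sub>R x\<^sup>2) s"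
      using normal_moment_odd[of "sqrt s" 0 0] normal_moment_even[of "sqrt s" 0 1] assms by simp_all
    then show ?thesis
      using False by (auto simp: normal_law_def intro!: has_bochner_integral_density)
  qed
  then show "has_bochner_integral (normal_law 0 s) (\<lambda>x. x) 0"
    and "has_bochner_integral (normal_law 0 s) (\<lambda>x. x\<^sup>2) s" by blast+
qed

lemma gaussian_vector_projection_moments:
  assumes "gaussian_vector P Z 0 \<Sigma>"
  shows "has_bochner_integral P (\<lambda>\<omega>. a \<bullet> Z \<omega>) 0"
    and "has_bochner_integral P (\<lambda>\<omega>. (a \<bullet> Z \<omega>)\<^sup>2) (a \<bullet> (\<Sigma> *v a))"
proof -
  have Z: "Z \<in> borel_measurable P" and s: "0 \<le> a \<bullet> (\<Sigma> *v a)"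
    and distr: "distr P borel (\<lambda>\<omega>. a \<bullet> Z \<omega>) = normal_law 0 (a \<bullet> (\<Sigma> *v a))"
    using assms by (auto simp: gaussian_vector_def)
  have X: "(\<lambda>\<omega>. a \<bullet> Z \<omega>) \<in> borel_measurable P"
    using Z by measurable
  have transfer: "has_bochner_integral P (\<lambda>\<omega>. f (a \<bullet> Z \<omega>)) m"
    if "has_bochner_integral (normal_law 0 (a \<bullet> (\<Sigma> *v a))) f m" "f \<in> borel_measurable borel"
    for f :: "real \<Rightarrow> real" and m
    using that(1) unfolding distr[symmetric] has_bochner_integral_iff
      integrable_distr_eq[OF X that(2)] integral_distr[OF X that(2)] .
  show "has_bochner_integral P (\<lambda>\<omega>. a \<bullet> Z \<omega>) 0"
    by (rule transfer[OF normal_law_moments(1)[OF s]]) measurable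
  show "has_bochner_integral P (\<lambda>\<omega>. (a \<bullet> Z \<omega>)\<^sup>2) (a \<bullet> (\<Sigma> *v a))"
    by (rule transfer[OF normal_law_moments(2)[OF s]]) measurable
qed

text \<open>The law of a Gaussian vector is given through its projections, so the variance is
  arranged into a constant, one linear projection of \<open>z\<close>, and squares of projections.
  The coordinate axes give the sum of squares, the all-ones vector gives the mean.\<close>

lemma vec_var_add:
  fixes x z :: "real^'n"
  defines "N \<equiv> real CARD('n)"
  shows "vec_var (x + z) = vec_var x + (\<chi> i. 2 * (x $ i - vec_mean x) / (N - 1)) \<bullet> z
     + ((\<Sum>i\<in>UNIV. (axis i 1 \<bullet> z)\<^sup>2) - ((\<chi> i. 1) \<bullet> z)\<^sup>2 / N) / (N - 1)"
proof -
  have N: "N > 0" by (simp add: N_def)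
  have sum_mean: "(\<Sum>i\<in>UNIV. u $ i) = N * vec_mean u" for u :: "real^'n"
    using N by (simp add: vec_mean_def N_def)
  have mean_add: "vec_mean (x + z) = vec_mean x + vec_mean z"
    by (simp add: vec_mean_def sum.distrib add_divide_distrib)
  have expand: "((x + z) $ i - vec_mean (x + z))\<^sup>2 = (x $ i - vec_mean x)\<^sup>2 + 2 * (x $ i - vec_mean x) * z $ i
      + (z $ i)\<^sup>2 - 2 * vec_mean z * (x $ i + z $ i) + 2 * vec_mean x * vec_mean z + (vec_mean z)\<^sup>2" for i
    by (simp add: mean_add power2_eq_square algebra_simps)
  have "(\<Sum>i\<in>UNIV. ((x + z) $ i - vec_mean (x + z))\<^sup>2) =
      (\<Sum>i\<in>UNIV. (x $ i - vec_mean x)\<^sup>2) + (\<Sum>i\<in>UNIV. 2 * (x $ i - vec_mean x) * z $ i)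
      + (\<Sum>i\<in>UNIV. (z $ i)\<^sup>2) - 2 * vec_mean z * (N * vec_mean x + N * vec_mean z)
      + N * (2 * vec_mean x * vec_mean z + (vec_mean z)\<^sup>2)"
    unfolding expand
    by (simp add: sum.distrib sum_subtractf sum_mean N_def distrib_left flip: sum_distrib_left)
  also have "\<dots> = (\<Sum>i\<in>UNIV. (x $ i - vec_mean x)\<^sup>2) + (\<Sum>i\<in>UNIV. 2 * (x $ i - vec_mean x) * z $ i)
      + ((\<Sum>i\<in>UNIV. (z $ i)\<^sup>2) - (N * vec_mean z)\<^sup>2 / N)"
    using N by (simp add: power2_eq_square algebra_simps)
  finally have "vec_var (x + z) = vec_var x + (\<Sum>i\<in>UNIV. 2 * (x $ i - vec_mean x) * z $ i) / (N - 1)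
      + ((\<Sum>i\<in>UNIV. (z $ i)\<^sup>2) - (N * vec_mean z)\<^sup>2 / N) / (N - 1)"
    by (simp only: vec_var_def add_divide_distrib N_def)
  moreover have "(\<chi> i. 2 * (x $ i - vec_mean x) / (N - 1)) \<bullet> z =
      (\<Sum>i\<in>UNIV. 2 * (x $ i - vec_mean x) * z $ i) / (N - 1)"
    by (simp add: inner_vec_def sum_divide_distrib)
  moreover have "axis i 1 \<bullet> z = z $ i" for i
    by (simp add: inner_axis')
  moreover have "(\<chi> i. 1) \<bullet> z = N * vec_mean z"
    by (simp add: inner_vec_def sum_mean)
  ultimately show ?thesis by simp
qed

text \<open>The linear projection has mean 0. Of the squares, the axes contribute the trace of the
  covariance and the all-ones vector contributes the sum of all its entries.\<close>

lemma expectation_vec_var: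
  fixes x :: "real^'n" and \<Sigma> :: "real^'n^'n"
  assumes "gaussian_vector P Z 0 \<Sigma>"
  shows "(\<integral>\<omega>. vec_var (x + Z \<omega>) \<partial>P) = vec_var x +
    ((\<Sum>i\<in>UNIV. \<Sigma> $ i $ i) - (\<Sum>i\<in>UNIV. \<Sum>j\<in>UNIV. \<Sigma> $ i $ j) / real CARD('n)) / (real CARD('n) - 1)"
proof -
  interpret prob_space P using assms by (simp add: gaussian_vector_def)
  note m = gaussian_vector_projection_moments[OF assms]
  have "has_bochner_integral P (\<lambda>_. vec_var x) (vec_var x)"
    by (simp add: has_bochner_integral_iff prob_space)
  then have "has_bochner_integral P (\<lambda>\<omega>. vec_var (x + Z \<omega>)) (vec_var x + 0 +
     ((\<Sum>i\<in>UNIV. axis i 1 \<bullet> (\<Sigma> *v axis i 1)) - ((\<chi> i. 1) \<bullet> (\<Sigma> *v (\<chi> i. 1))) / real CARD('n)) / (real CARD('n) - 1))"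
    unfolding vec_var_add
    by (intro has_bochner_integral_add has_bochner_integral_diff has_bochner_integral_divide_zero
        has_bochner_integral_sum m) auto
  moreover have "axis i 1 \<bullet> (\<Sigma> *v axis i 1) = \<Sigma> $ i $ i" for i
    by (simp add: inner_axis' matrix_vector_mult_basis column_def)
  moreover have "(\<chi> i. 1) \<bullet> (\<Sigma> *v (\<chi> i. 1)) = (\<Sum>i\<in>UNIV. \<Sum>j\<in>UNIV. \<Sigma> $ i $ j)"
    by (simp add: inner_vec_def matrix_vector_mult_def)
  ultimately show ?thesis
    by (simp add: has_bochner_integral_iff)
qed

section \<open>The spatial factor 1 - rho and its positivity\<close>

text \<open>This is the usual decomposition of a sum of squares into mean and deviations, for a
  complex unit vector. It shows that 1 - rho vanishes only if all entries of \<open>v\<close>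
  agree.\<close>

lemma one_minus_hopf_rho:
  fixes v :: "complex^'n"
  defines "m \<equiv> (\<Sum>i\<in>UNIV. v $ i) / of_nat CARD('n)"
  assumes "norm v = 1"
  shows "1 - hopf_rho v = (\<Sum>i\<in>UNIV. (cmod (v $ i - m))\<^sup>2)"
proof -
  let ?N = "real CARD('n)"
  have v: "(\<Sum>i\<in>UNIV. (cmod (v $ i))\<^sup>2) = 1"
    using assms(2) by (simp add: norm_vec_def L2_set_def)
  have sum: "(\<Sum>i\<in>UNIV. v $ i) = of_real ?N * m"
    by (simp add: m_def)
  have "(\<Sum>i\<in>UNIV. (cmod (v $ i - m))\<^sup>2) = (\<Sum>i\<in>UNIV. (cmod (v $ i))\<^sup>2 - 2 * Re (v $ i * cnj m) + (cmod m)\<^sup>2)"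
    by (intro sum.cong refl, simp only: cmod_power2) (simp add: power2_eq_square algebra_simps)
  also have "\<dots> = 1 - 2 * Re ((\<Sum>i\<in>UNIV. v $ i) * cnj m) + ?N * (cmod m)\<^sup>2"
  proof -
    have "(\<Sum>i\<in>UNIV. Re (v $ i * cnj m)) = Re ((\<Sum>i\<in>UNIV. v $ i) * cnj m)"
      by (simp only: sum_distrib_right Re_sum)
    then show ?thesis
      by (simp add: sum.distrib sum_subtractf v del: times_complex.sel flip: sum_distrib_left)
  qed
  also have "(\<Sum>i\<in>UNIV. v $ i) * cnj m = of_real (?N * (cmod m)\<^sup>2)"
    by (simp only: sum mult.assoc of_real_mult complex_norm_square)
  also have "1 - 2 * Re (of_real (?N * (cmod m)\<^sup>2)) + ?N * (cmod m)\<^sup>2 = 1 - hopf_rho v"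
    by (simp add: hopf_rho_def sum norm_mult power_mult_distrib power2_eq_square)
  finally show ?thesis by simp
qed

lemma hopf_rho_less_1:
  assumes "norm v = 1" "tdot w v = 1" "tdot w (cnj_vec v) = 0"
  shows "hopf_rho v < 1"
proof (rule ccontr)
  define m where "m = (\<Sum>i\<in>UNIV. v $ i) / of_nat CARD('a)"
  assume "\<not> hopf_rho v < 1"
  then have "(\<Sum>i\<in>UNIV. (cmod (v $ i - m))\<^sup>2) \<le> 0"
    using one_minus_hopf_rho[OF assms(1)] by (simp add: m_def)
  then have "(\<Sum>i\<in>UNIV. (cmod (v $ i - m))\<^sup>2) = 0"
    by (intro antisym sum_nonneg) auto
  then have "v $ i = m" for i
    by (simp add: sum_nonneg_eq_0_iff)
  \<comment> \<open>The first equation makes both factors nonzero, while the second forces one of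
    them to vanish.\<close>
  then have "(\<Sum>i\<in>UNIV. w $ i) * m = 1" "(\<Sum>i\<in>UNIV. w $ i) * cnj m = 0"
    using assms(2,3) by (simp_all add: tdot_def cnj_vec_def sum_distrib_right)
  then show False by auto
qed

section \<open>Boundedness of the linearization along the branch\<close>

text \<open>The joint derivative \<open>f'\<close> is itself differentiable on \<open>U\<close>,
  hence continuous at the endpoint \<open>(xc, \<alpha>c)\<close>, so its norm is bounded along the
  branch near \<alpha>c. The entries of the linearization are bounded by this norm.\<close>

lemma linearization_bounded:
  fixes F :: "real^'n \<Rightarrow> real \<Rightarrow> real^'n"
  assumes C2: "C2_on (\<lambda>(x, \<alpha>). F x \<alpha>) U" and "(xc, \<alpha>c) \<in> U"
    and U: "\<forall>\<^sub>F \<alpha> in at_left \<alpha>c. (xs \<alpha>, \<alpha>) \<in> U"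
    and lim: "(xs \<longlongrightarrow> xc) (at_left \<alpha>c)"
  shows "\<exists>b. \<forall>\<^sub>F \<alpha> in at_left \<alpha>c. \<forall>i j. \<bar>linearization F xs \<alpha> $ i $ j\<bar> \<le> b"
proof -
  obtain f' where f': "\<And>p. p \<in> U \<Longrightarrow> ((\<lambda>(x, \<alpha>). F x \<alpha>) has_derivative blinfun_apply (f' p)) (at p)"
    and cont: "\<And>p. p \<in> U \<Longrightarrow> isCont f' p"
    using C2 has_derivative_continuous unfolding C2_on_def by metis
  have "((\<lambda>\<alpha>. (xs \<alpha>, \<alpha>)) \<longlongrightarrow> (xc, \<alpha>c)) (at_left \<alpha>c)"
    by (intro tendsto_Pair lim tendsto_ident_at)
  then have "((\<lambda>\<alpha>. norm (f' (xs \<alpha>, \<alpha>))) \<longlongrightarrow> norm (f' (xc, \<alpha>c))) (at_left \<alpha>c)"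
    by (intro tendsto_norm isCont_tendsto_compose[OF cont] \<open>(xc, \<alpha>c) \<in> U\<close>)
  then have "\<forall>\<^sub>F \<alpha> in at_left \<alpha>c. norm (f' (xs \<alpha>, \<alpha>)) < norm (f' (xc, \<alpha>c)) + 1"
    by (rule order_tendstoD) simp
  then have "\<forall>\<^sub>F \<alpha> in at_left \<alpha>c. \<forall>i j. \<bar>linearization F xs \<alpha> $ i $ j\<bar> \<le> norm (f' (xc, \<alpha>c)) + 1"
    using U
  proof eventually_elim
    case (elim \<alpha>)
    \<comment> \<open>Composition with this embedding expresses the derivative in the state at fixed
      \<alpha> as the joint derivative on directions \<open>(h, 0)\<close>.\<close>
    have "((\<lambda>x. (x, \<alpha>)) has_derivative (\<lambda>h. (h, 0))) (at (xs \<alpha>))"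
      by (auto intro!: derivative_eq_intros)
    from has_derivative_compose[OF this f'[OF elim(2)]]
    have "((\<lambda>x. F x \<alpha>) has_derivative (\<lambda>h. f' (xs \<alpha>, \<alpha>) (h, 0))) (at (xs \<alpha>))"
      by simp
    then have D: "frechet_derivative (\<lambda>x. F x \<alpha>) (at (xs \<alpha>)) = (\<lambda>h. f' (xs \<alpha>, \<alpha>) (h, 0))"
      by (rule frechet_derivative_at[symmetric])
    show ?case
    proof (intro allI)
      fix i j
      have "\<bar>linearization F xs \<alpha> $ i $ j\<bar> \<le> norm (f' (xs \<alpha>, \<alpha>) (axis j 1, 0))"
        by (simp add: linearization_def jacobian_def matrix_def D component_le_norm_cart)
      also have "\<dots> \<le> norm (f' (xs \<alpha>, \<alpha>)) * norm (axis j (1::real), 0::real)"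
        by (rule norm_blinfun)
      finally show "\<bar>linearization F xs \<alpha> $ i $ j\<bar> \<le> norm (f' (xc, \<alpha>c)) + 1"
        using elim(1) by (simp add: norm_Pair)
    qed
  qed
  then show ?thesis by blast
qed

section \<open>From covariance entries to the variance, and limits of scalar quantities\<close>

text \<open>For a unit vector \<open>v\<close> the leading part has trace g and total sum g N rho,
  which gives the subtracted term exactly. In the remainder, the trace and the total sum divided by
  N are each at most N K.\<close>

lemma hopf_variance_error:
  fixes C :: "real^'n^'n" and v :: "complex^'n"
  assumes "CARD('n) \<ge> 2" and v: "norm v = 1"
    and C: "\<And>i j. \<bar>C $ i $ j - g * Re (v $ i * cnj (v $ j))\<bar> \<le> K"
  shows "\<bar>((\<Sum>i\<in>UNIV. C $ i $ i) - (\<Sum>i\<in>UNIV. \<Sum>j\<in>UNIV. C $ i $ j) / real CARD('n)) / (real CARD('n) - 1)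
      - g * ((1 - hopf_rho v) / (real CARD('n) - 1))\<bar> \<le> 2 * real CARD('n) * K / (real CARD('n) - 1)"
proof -
  let ?N = "real CARD('n)"
  define R where "R i j = C $ i $ j - g * Re (v $ i * cnj (v $ j))" for i j
  have N: "?N \<ge> 2" using assms(1) by simp
  have C_eq: "C $ i $ j = R i j + g * Re (v $ i * cnj (v $ j))" for i j
    by (simp add: R_def)
  have diag: "(\<Sum>i\<in>UNIV. Re (v $ i * cnj (v $ i))) = 1"
  proof -
    have "Re (v $ i * cnj (v $ i)) = (cmod (v $ i))\<^sup>2" for i
      by (simp only: complex_norm_square[symmetric] Re_complex_of_real)
    then show ?thesis
      using v by (simp add: norm_vec_def L2_set_def del: times_complex.sel)
  qed
  have "(\<Sum>i\<in>UNIV. \<Sum>j\<in>UNIV. Re (v $ i * cnj (v $ j))) = Re ((\<Sum>i\<in>UNIV. v $ i) * cnj (\<Sum>i\<in>UNIV. v $ i))"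
    by (simp only: cnj_sum sum_product Re_sum)
  also have "\<dots> = ?N * hopf_rho v"
    by (simp only: complex_norm_square[symmetric] Re_complex_of_real) (simp add: hopf_rho_def)
  finally have off: "(\<Sum>i\<in>UNIV. \<Sum>j\<in>UNIV. Re (v $ i * cnj (v $ j))) = ?N * hopf_rho v" .
  have sum_diag: "(\<Sum>i\<in>UNIV. C $ i $ i) = (\<Sum>i\<in>UNIV. R i i) + g"
    unfolding C_eq sum.distrib sum_distrib_left[symmetric] diag by simp
  have sum_all: "(\<Sum>i\<in>UNIV. \<Sum>j\<in>UNIV. C $ i $ j) = (\<Sum>i\<in>UNIV. \<Sum>j\<in>UNIV. R i j) + g * (?N * hopf_rho v)"
    unfolding C_eq sum.distrib sum_distrib_left[symmetric] off ..
  have R1: "\<bar>\<Sum>i\<in>UNIV. R i i\<bar> \<le> ?N * K"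
    using sum_norm_bound[of UNIV "\<lambda>i. R i i" K] C by (simp add: R_def)
  have "\<bar>\<Sum>j\<in>UNIV. R i j\<bar> \<le> ?N * K" for i
    using sum_norm_bound[of UNIV "R i" K] C by (simp add: R_def)
  then have "\<bar>\<Sum>i\<in>UNIV. \<Sum>j\<in>UNIV. R i j\<bar> \<le> ?N * (?N * K)"
    using sum_norm_bound[of UNIV "\<lambda>i. \<Sum>j\<in>UNIV. R i j" "?N * K"] by simp
  then have R2: "\<bar>(\<Sum>i\<in>UNIV. \<Sum>j\<in>UNIV. R i j) / ?N\<bar> \<le> ?N * K"
    using N by (simp add: field_simps)
  have "((\<Sum>i\<in>UNIV. C $ i $ i) - (\<Sum>i\<in>UNIV. \<Sum>j\<in>UNIV. C $ i $ j) / ?N) / (?N - 1) - g * ((1 - hopf_rho v) / (?N - 1))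
      = ((\<Sum>i\<in>UNIV. R i i) - (\<Sum>i\<in>UNIV. \<Sum>j\<in>UNIV. R i j) / ?N) / (?N - 1)"
    unfolding sum_diag sum_all using N by (simp add: add_divide_distrib diff_divide_distrib right_diff_distrib)
  also have "\<bar>\<dots>\<bar> \<le> 2 * ?N * K / (?N - 1)"
  proof -
    have "\<bar>(\<Sum>i\<in>UNIV. R i i) - (\<Sum>i\<in>UNIV. \<Sum>j\<in>UNIV. R i j) / ?N\<bar> \<le> 2 * ?N * K"
      using R1 R2 by linarith
    then show ?thesis
      using N unfolding abs_divide by (simp add: divide_right_mono)
  qed
  finally show ?thesis .
qed

lemma tendsto_tdot:
  "(f \<longlongrightarrow> a) F \<Longrightarrow> (g \<longlongrightarrow> b) F \<Longrightarrow> ((\<lambda>x. tdot (f x) (g x)) \<longlongrightarrow> tdot a b) F"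
  unfolding tdot_def by (intro tendsto_intros)

lemma tendsto_cnj_vec: "(f \<longlongrightarrow> a) F \<Longrightarrow> ((\<lambda>x. cnj_vec (f x)) \<longlongrightarrow> cnj_vec a) F"
  unfolding cnj_vec_def by (intro tendsto_intros)

lemma tendsto_hopf_rho: "(f \<longlongrightarrow> a) F \<Longrightarrow> ((\<lambda>x. hopf_rho (f x)) \<longlongrightarrow> hopf_rho a) F"
  unfolding hopf_rho_def divide_inverse by (intro tendsto_intros)

lemma tendsto_vec_var: "(f \<longlongrightarrow> a) F \<Longrightarrow> ((\<lambda>x. vec_var (f x)) \<longlongrightarrow> vec_var (a :: real^'n)) F"
  unfolding vec_var_def vec_mean_def divide_inverse by (intro tendsto_intros)

lemma tendsto_hopf_noise: "(f \<longlongrightarrow> a) F \<Longrightarrow> ((\<lambda>x. hopf_noise B (f x)) \<longlongrightarrow> hopf_noise B a) F"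
  unfolding hopf_noise_def matrix_vector_mult_def by (intro tendsto_intros)

section \<open>Asymptotics of the expected variance as \<alpha> tends to \<alpha>c\<close>

theorem theoremE3:
  fixes F :: "real^'n \<Rightarrow> real \<Rightarrow> real^'n"
    and B :: "real^'m^'n"
    and xs :: "real \<Rightarrow> real^'n" and xc :: "real^'n"
    and \<alpha>0 \<alpha>c :: real
    and U :: "((real^'n) \<times> real) set"
    and C :: "real \<Rightarrow> real^'n^'n"
    and \<eta> \<Omega> :: "real \<Rightarrow> real"
    and v w :: "real \<Rightarrow> complex^'n"
    and P :: "real \<Rightarrow> 'w measure" and z :: "real \<Rightarrow> 'w \<Rightarrow> real^'n"
  assumes dim: "CARD('n) \<ge> 2"
    and range: "\<alpha>0 < \<alpha>c"
    and smooth: "open U" "\<And>\<alpha>. \<alpha> \<in> {\<alpha>0<..<\<alpha>c} \<Longrightarrow> (xs \<alpha>, \<alpha>) \<in> U" "(xc, \<alpha>c) \<in> U"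
      "C2_on (\<lambda>(x, \<alpha>). F x \<alpha>) U"
    and equilibrium: "\<And>\<alpha>. \<alpha> \<in> {\<alpha>0<..<\<alpha>c} \<Longrightarrow> F (xs \<alpha>) \<alpha> = 0"
    and stable: "\<And>\<alpha>. \<alpha> \<in> {\<alpha>0<..<\<alpha>c} \<Longrightarrow> asymptotically_stable (\<lambda>x. F x \<alpha>) (xs \<alpha>)"
    and branch_limit: "(xs \<longlongrightarrow> xc) (at_left \<alpha>c)"
    and lyapunov: "\<And>\<alpha>. \<alpha> \<in> {\<alpha>0<..<\<alpha>c} \<Longrightarrow>
      linearization F xs \<alpha> ** C \<alpha> + C \<alpha> ** transpose (linearization F xs \<alpha>) = B ** transpose B"
    and hopf: "simple_hopf_pair (linearization F xs) \<alpha>c \<eta> \<Omega> v w"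
    and gauss: "\<And>\<alpha>. \<alpha> \<in> {\<alpha>0<..<\<alpha>c} \<Longrightarrow> gaussian_vector (P \<alpha>) (z \<alpha>) 0 (C \<alpha>)"
  shows
    "(\<lambda>\<alpha>. (\<integral>\<omega>. vec_var (xs \<alpha> + z \<alpha> \<omega>) \<partial>P \<alpha>)
          - (vec_var (xs \<alpha>)
             + hopf_noise B (w \<alpha>) / \<eta> \<alpha> * ((1 - hopf_rho (v \<alpha>)) / (real CARD('n) - 1))))
       \<in> O[at_left \<alpha>c](\<lambda>_. 1) \<and>
     (\<forall>\<kappa> \<sigma>c2.
        \<kappa> > 0 \<and>
        (\<exists>r. r \<in> o[at_left \<alpha>c](\<lambda>_. 1) \<and>
             (\<forall>\<^sub>F \<alpha> in at_left \<alpha>c. \<eta> \<alpha> = \<kappa> * (\<alpha>c - \<alpha>) * (1 + r \<alpha>))) \<and>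
        ((\<lambda>\<alpha>. hopf_noise B (w \<alpha>)) \<longlongrightarrow> \<sigma>c2) (at_left \<alpha>c) \<and> \<sigma>c2 > 0 \<longrightarrow>
        (\<exists>L>0. ((\<lambda>\<alpha>. (\<alpha>c - \<alpha>) * (\<integral>\<omega>. vec_var (xs \<alpha> + z \<alpha> \<omega>) \<partial>P \<alpha>)) \<longlongrightarrow> L) (at_left \<alpha>c)))"
proof -
  let ?N = "real CARD('n)" and ?l = "at_left \<alpha>c"
  let ?E = "\<lambda>\<alpha>. \<integral>\<omega>. vec_var (xs \<alpha> + z \<alpha> \<omega>) \<partial>P \<alpha>"
  define T where "T \<alpha> = ?E \<alpha> - (vec_var (xs \<alpha>)
      + hopf_noise B (w \<alpha>) / \<eta> \<alpha> * ((1 - hopf_rho (v \<alpha>)) / (?N - 1)))" for \<alpha>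
  have interval: "\<forall>\<^sub>F \<alpha> in ?l. \<alpha> \<in> {\<alpha>0<..<\<alpha>c}"
    using range by (rule eventually_at_left_real)
  \<comment> \<open>The conditions on the Hopf pair at a single \<alpha>, bundled into one predicate
    that is carried as one eventual fact.\<close>
  define modes where "modes = (\<lambda>\<alpha>. let M = linearization F xs \<alpha>; l = Complex (\<eta> \<alpha>) (\<Omega> \<alpha>); l' = Complex (\<eta> \<alpha>) (- \<Omega> \<alpha>) in
        diagonalizable (cmat M) \<and> simple_eigenvalue (cmat M) l \<and> simple_eigenvalue (cmat M) l' \<and> \<eta> \<alpha> > 0 \<and>
        right_eigenvector (cmat M) l (v \<alpha>) \<and> right_eigenvector (cmat M) l' (cnj_vec (v \<alpha>)) \<and>
        left_eigenvector (cmat M) l (w \<alpha>) \<and> left_eigenvector (cmat M) l' (cnj_vec (w \<alpha>)) \<and>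
        norm (v \<alpha>) = 1 \<and> tdot (w \<alpha>) (v \<alpha>) = 1 \<and> tdot (w \<alpha>) (cnj_vec (v \<alpha>)) = 0)"
  have modes: "\<forall>\<^sub>F \<alpha> in ?l. modes \<alpha>"
    using hopf unfolding simple_hopf_pair_def modes_def Let_def by blast
  obtain \<Omega>c \<delta> vc wc where "\<Omega>c > 0" "\<delta> > 0" and \<Omega>c: "(\<Omega> \<longlongrightarrow> \<Omega>c) ?l"
    and \<delta>: "\<forall>\<^sub>F \<alpha> in ?l. \<forall>\<mu>. eigenvalue (cmat (linearization F xs \<alpha>)) \<mu> \<and>
        \<mu> \<noteq> Complex (\<eta> \<alpha>) (\<Omega> \<alpha>) \<and> \<mu> \<noteq> Complex (\<eta> \<alpha>) (- \<Omega> \<alpha>) \<longrightarrow> Re \<mu> \<ge> \<delta>"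
    and vc: "(v \<longlongrightarrow> vc) ?l" and wc: "(w \<longlongrightarrow> wc) ?l"
    using hopf unfolding simple_hopf_pair_def by blast
  obtain bM where bM: "\<forall>\<^sub>F \<alpha> in ?l. \<forall>i j. \<bar>linearization F xs \<alpha> $ i $ j\<bar> \<le> bM"
    using linearization_bounded[OF smooth(4,3) eventually_mono[OF interval smooth(2)] branch_limit] by blast
  define bw where "bw = norm wc + 1"
  have bw: "\<forall>\<^sub>F \<alpha> in ?l. norm (w \<alpha>) < bw"
    unfolding bw_def by (rule order_tendstoD(2)[OF tendsto_norm[OF wc]]) simp
  define bh where "bh = hopf_noise B wc + 1"
  have bh: "\<forall>\<^sub>F \<alpha> in ?l. hopf_noise B (w \<alpha>) < bh"
    unfolding bh_def by (rule order_tendstoD(2)[OF tendsto_hopf_noise[OF wc]]) simp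
  define bD where "bD = norm (B ** transpose B)"
  have bD: "\<bar>(B ** transpose B) $ i $ j\<bar> \<le> bD" for i j
    unfolding bD_def using Finite_Cartesian_Product.norm_nth_le order.trans real_norm_def by metis
  \<comment> \<open>One number dominating the linearization, the left eigenvector, the noise
    intensity and the noise matrix, uniformly near \<alpha>c.\<close>
  define b where "b = Max {bM, bw, bh, bD}"
  have b: "bM \<le> b" "bw \<le> b" "bh \<le> b" "bD \<le> b"
    by (auto simp: b_def)
  \<comment> \<open>Each member of the minimum guards one kind of eigenvalue sum: 1 the raised pair,
    \<delta> sums involving other eigenvalues, and half the limit frequency the doubled Hopf
    eigenvalues.\<close>
  define c where "c = Min {1, \<delta>, \<Omega>c / 2}"
  have c: "0 < c" "c \<le> 1" "c \<le> \<delta>" "c \<le> \<Omega>c / 2"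
    using \<open>\<delta> > 0\<close> \<open>\<Omega>c > 0\<close> by (auto simp: c_def)
  have \<Omega>: "\<forall>\<^sub>F \<alpha> in ?l. \<Omega>c / 2 < \<Omega> \<alpha>"
    by (rule order_tendstoD(1)[OF \<Omega>c]) (use \<open>\<Omega>c > 0\<close> in simp)
  define K where "K = fact CARD('n \<times> 'n) * (3 * b + 2 * b\<^sup>2) ^ CARD('n \<times> 'n) / c ^ CARD('n \<times> 'n)"
  have T_bound: "\<forall>\<^sub>F \<alpha> in ?l. \<bar>T \<alpha>\<bar> \<le> 2 * ?N * K / (?N - 1)"
    using interval modes \<delta> bM bw bh \<Omega>
  proof eventually_elim
    case (elim \<alpha>)
    let ?M = "linearization F xs \<alpha>"
    have C: "\<bar>C \<alpha> $ i $ j - hopf_noise B (w \<alpha>) / \<eta> \<alpha> * Re (v \<alpha> $ i * cnj (v \<alpha> $ j))\<bar> \<le> K" for i j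
      unfolding K_def
    proof (rule lyapunov_hopf_bound[where M = "?M" and \<Omega> = "\<Omega> \<alpha>"])
      show "c \<le> Re \<mu>" if "eigenvalue (cmat ?M) \<mu>"
        "\<mu> \<noteq> Complex (\<eta> \<alpha>) (\<Omega> \<alpha>)" "\<mu> \<noteq> Complex (\<eta> \<alpha>) (- \<Omega> \<alpha>)" for \<mu>
        using elim(3) that c(3) order.trans by blast
      show "cmod (w \<alpha> $ i) \<le> b" for i
        using Finite_Cartesian_Product.norm_nth_le[of "w \<alpha>" i] elim(5) b(2) by linarith
      show "\<bar>?M $ i $ j\<bar> \<le> b" for i j
        using elim(4) b(1) order.trans by blast
      show "\<bar>(B ** transpose B) $ i $ j\<bar> \<le> b" for i j
        using bD b(4) order.trans by blast
    qed (use elim(1,2,6,7) b(3) c lyapunov in \<open>auto simp: modes_def Let_def\<close>)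
    have "norm (v \<alpha>) = 1"
      using elim(2) by (simp add: modes_def Let_def)
    from hopf_variance_error[OF dim this C] show ?case
      unfolding T_def expectation_vec_var[OF gauss[OF elim(1)]] by (simp add: algebra_simps)
  qed
  have "T \<in> O[?l](\<lambda>_. 1)"
    by (rule bigoI[where c = "2 * ?N * K / (?N - 1)"]) (use T_bound in simp)
  moreover have "\<exists>L>0. ((\<lambda>\<alpha>. (\<alpha>c - \<alpha>) * ?E \<alpha>) \<longlongrightarrow> L) ?l"
    if "\<kappa> > 0" and r: "r \<in> o[?l](\<lambda>_. 1)" "\<forall>\<^sub>F \<alpha> in ?l. \<eta> \<alpha> = \<kappa> * (\<alpha>c - \<alpha>) * (1 + r \<alpha>)"
      and \<sigma>: "((\<lambda>\<alpha>. hopf_noise B (w \<alpha>)) \<longlongrightarrow> \<sigma>c2) ?l" "\<sigma>c2 > 0" for \<kappa> \<sigma>c2 r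
  proof -
    \<comment> \<open>The normalizations pass to the limit, so that rho is below 1 for the limit
      vector as well; this keeps 1 - rho from tending to 0.\<close>
    have "norm vc = 1"
    proof (rule tendsto_unique[OF trivial_limit_at_left_real tendsto_norm[OF vc]])
      show "((\<lambda>\<alpha>. norm (v \<alpha>)) \<longlongrightarrow> 1) ?l"
        by (rule tendsto_eventually) (use modes in \<open>auto simp: modes_def Let_def elim: eventually_mono\<close>)
    qed
    moreover have "tdot wc vc = 1"
    proof (rule tendsto_unique[OF trivial_limit_at_left_real tendsto_tdot[OF wc vc]])
      show "((\<lambda>\<alpha>. tdot (w \<alpha>) (v \<alpha>)) \<longlongrightarrow> 1) ?l"
        by (rule tendsto_eventually) (use modes in \<open>auto simp: modes_def Let_def elim: eventually_mono\<close>)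
    qed
    moreover have "tdot wc (cnj_vec vc) = 0"
    proof (rule tendsto_unique[OF trivial_limit_at_left_real tendsto_tdot[OF wc tendsto_cnj_vec[OF vc]]])
      show "((\<lambda>\<alpha>. tdot (w \<alpha>) (cnj_vec (v \<alpha>))) \<longlongrightarrow> 0) ?l"
        by (rule tendsto_eventually) (use modes in \<open>auto simp: modes_def Let_def elim: eventually_mono\<close>)
    qed
    ultimately have \<rho>: "hopf_rho vc < 1"
      by (rule hopf_rho_less_1)
    have to_0: "((\<lambda>\<alpha>. \<alpha>c - \<alpha>) \<longlongrightarrow> 0) ?l"
      by (auto intro!: tendsto_eq_intros)
    have lim_T: "((\<lambda>\<alpha>. (\<alpha>c - \<alpha>) * T \<alpha>) \<longlongrightarrow> 0) ?l"
    proof (rule Lim_null_comparison)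
      show "\<forall>\<^sub>F \<alpha> in ?l. norm ((\<alpha>c - \<alpha>) * T \<alpha>) \<le> \<bar>\<alpha>c - \<alpha>\<bar> * (2 * ?N * K / (?N - 1))"
        using T_bound by eventually_elim (simp only: real_norm_def abs_mult mult_left_mono abs_ge_zero)
      show "((\<lambda>\<alpha>. \<bar>\<alpha>c - \<alpha>\<bar> * (2 * ?N * K / (?N - 1))) \<longlongrightarrow> 0) ?l"
        by (intro tendsto_mult_left_zero tendsto_rabs_zero to_0)
    qed
    have lim_S: "((\<lambda>\<alpha>. (\<alpha>c - \<alpha>) * vec_var (xs \<alpha>)) \<longlongrightarrow> 0 * vec_var xc) ?l"
      by (intro tendsto_mult to_0 tendsto_vec_var branch_limit)
    \<comment> \<open>On the interval \<alpha>c - \<alpha> is nonzero and cancels, leaving 1 /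
      (\<kappa> (1 + r)).\<close>
    have lim_\<eta>: "((\<lambda>\<alpha>. (\<alpha>c - \<alpha>) / \<eta> \<alpha>) \<longlongrightarrow> 1 / \<kappa>) ?l"
    proof (rule Lim_transform_eventually)
      have "(r \<longlongrightarrow> 0) ?l"
        using smalloD_tendsto[OF r(1)] by simp
      then show "((\<lambda>\<alpha>. 1 / (\<kappa> * (1 + r \<alpha>))) \<longlongrightarrow> 1 / \<kappa>) ?l"
        using \<open>\<kappa> > 0\<close> by (auto intro!: tendsto_eq_intros)
      show "\<forall>\<^sub>F \<alpha> in ?l. 1 / (\<kappa> * (1 + r \<alpha>)) = (\<alpha>c - \<alpha>) / \<eta> \<alpha>"
        using r(2) interval by eventually_elim simp
    qed
    have "((\<lambda>\<alpha>. hopf_noise B (w \<alpha>) * ((1 - hopf_rho (v \<alpha>)) / (?N - 1)))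
        \<longlongrightarrow> \<sigma>c2 * ((1 - hopf_rho vc) / (?N - 1))) ?l"
      unfolding divide_inverse by (intro tendsto_mult \<sigma>(1) tendsto_diff tendsto_const tendsto_hopf_rho vc)
    \<comment> \<open>After scaling by \<alpha>c - \<alpha>, the bounded error and the variance of
      the equilibrium vanish in the limit; only the Hopf term contributes to the limit
      \<open>L\<close>.\<close>
    from tendsto_add[OF tendsto_add[OF lim_T lim_S] tendsto_mult[OF lim_\<eta> this]]
    have "((\<lambda>\<alpha>. (\<alpha>c - \<alpha>) * T \<alpha> + (\<alpha>c - \<alpha>) * vec_var (xs \<alpha>)
        + (\<alpha>c - \<alpha>) / \<eta> \<alpha> * (hopf_noise B (w \<alpha>) * ((1 - hopf_rho (v \<alpha>)) / (?N - 1))))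
        \<longlongrightarrow> 0 + 0 * vec_var xc + 1 / \<kappa> * (\<sigma>c2 * ((1 - hopf_rho vc) / (?N - 1)))) ?l" .
    moreover have "(\<alpha>c - \<alpha>) * T \<alpha> + (\<alpha>c - \<alpha>) * vec_var (xs \<alpha>)
        + (\<alpha>c - \<alpha>) / \<eta> \<alpha> * (hopf_noise B (w \<alpha>) * ((1 - hopf_rho (v \<alpha>)) / (?N - 1))) = (\<alpha>c - \<alpha>) * ?E \<alpha>" for \<alpha>
      unfolding T_def by (simp add: distrib_left right_diff_distrib[of "\<alpha>c - \<alpha>"])
    moreover have "0 + 0 * vec_var xc + 1 / \<kappa> * (\<sigma>c2 * ((1 - hopf_rho vc) / (?N - 1))) > 0"
      using \<open>\<kappa> > 0\<close> \<sigma>(2) \<rho> dim by simp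
    ultimately show ?thesis by auto
  qed
  ultimately show ?thesis
    unfolding T_def by blast
qed

end
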